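(* Let $G$ be a finite abelian group. Then $d(G)\in\{1,2,4\}$. In particular: (i) if $d(G)=1$, then $G$ is not a generalised Beauville group; (ii) if $d(G)=2$, then $G$ is a Beauville group; (iii) if $d(G)=4$, then $G$ is a generalised Beauville group of the form $G\cong C_n\times C_n\times H$, where $n$ is a power of $3$ and $H$ is either the trivial group or an abelian Beauville group.
   Context: $C_n$ denotes the cyclic group of order $n$. For a finite group $G$ and $x,y\in G$, let $\Sigma(x,y)=\bigcup_{i=1}^{|G|}\bigcup_{k\in G}\{(x^i)^k,(y^i)^k,((xy)^i)^k\}$, where $g^k$ for $k \in G$ denotes the conjugate of $g$ by $k$; that is, $\Sigma(x,y)$ is the union of all conjugates in $G$ of the cyclic subgroups $\langle x\rangle,\langle y\rangle,\langle xy\rangle$. The Beauville dimension $d(G)$ of a finite group $G$ is the minimum number $d$ of sets $\Sigma(x_i,y_i)$ ($i=1,\dots,d$), with $\langle x_i,y_i\rangle=G$ for every $i$, such that $\bigcap_{i=1}^d\Sigma(x_i,y_i)=\{e\}$ (so the trivial group has $d=1$). If there is a non-identity element of $G$ contained in every set $\Sigma(x,y)$ with $\langle x,y\rangle=G$, then $d(G)=1$ by convention; this condition holds vacuously, so $d(G)=1$, if $G$ is non-trivial and not generated by two elements. A generalised Beauville group is a finite group $G$ with $d(G)\ge 2$. A Beauville group is a non-trivial finite group having two generating pairs $(x_1,y_1),(x_2,y_2)$ with $\Sigma(x_1,y_1)\cap\Sigma(x_2,y_2)=\{e\}$. *)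

theory Defs
  imports "HOL-Algebra.Elementary_Groups"
begin

definition generating_pair :: "('a, 'b) monoid_scheme \<Rightarrow> 'a \<Rightarrow> 'a \<Rightarrow> bool" where
  "generating_pair G x y \<longleftrightarrow>
     x \<in> carrier G \<and> y \<in> carrier G \<and> generate G {x, y} = carrier G"

definition conjugate_by :: "('a, 'b) monoid_scheme \<Rightarrow> 'a \<Rightarrow> 'a \<Rightarrow> 'a" where
  "conjugate_by G g k = inv\<^bsub>G\<^esub> k \<otimes>\<^bsub>G\<^esub> g \<otimes>\<^bsub>G\<^esub> k"

definition beauville_Sigma :: "('a, 'b) monoid_scheme \<Rightarrow> 'a \<Rightarrow> 'a \<Rightarrow> 'a set" where
  "beauville_Sigma G x y =
     (\<Union>i \<in> {1..order G}. \<Union>k \<in> carrier G.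
        {conjugate_by G (x [^]\<^bsub>G\<^esub> i) k,
         conjugate_by G (y [^]\<^bsub>G\<^esub> i) k,
         conjugate_by G ((x \<otimes>\<^bsub>G\<^esub> y) [^]\<^bsub>G\<^esub> i) k})"

text \<open>
  The first branch is the convention that the dimension is 1 when some non-identity element
  lies in every \<open>\<Sigma>(x, y)\<close>; it includes, vacuously, the non-trivial groups without a generating
  pair. In the second branch, for finite \<open>G\<close>, the minimum is taken over a non-empty set: the
  finitely many sets \<open>\<Sigma>(x, y)\<close> of generating pairs intersect in the identity. The bound \<open>d \<ge> 1\<close>
  gives the trivial group dimension 1.
\<close>

definition beauville_dimension :: "('a, 'b) monoid_scheme \<Rightarrow> nat" where
  "beauville_dimension G =
     (if \<exists>g \<in> carrier G. g \<noteq> \<one>\<^bsub>G\<^esub> \<and>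
           (\<forall>x y. generating_pair G x y \<longrightarrow> g \<in> beauville_Sigma G x y)
      then 1
      else (LEAST d. d \<ge> 1 \<and>
              (\<exists>x y :: nat \<Rightarrow> 'a.
                 (\<forall>i \<in> {1..d}. generating_pair G (x i) (y i)) \<and>
                 (\<Inter>i \<in> {1..d}. beauville_Sigma G (x i) (y i)) = {\<one>\<^bsub>G\<^esub>})))"

definition generalised_beauville_group :: "('a, 'b) monoid_scheme \<Rightarrow> bool" where
  "generalised_beauville_group G \<longleftrightarrow>
     group G \<and> finite (carrier G) \<and> beauville_dimension G \<ge> 2"

definition beauville_group :: "('a, 'b) monoid_scheme \<Rightarrow> bool" where
  "beauville_group G \<longleftrightarrow>
     group G \<and> finite (carrier G) \<and> carrier G \<noteq> {\<one>\<^bsub>G\<^esub>} \<and>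
     (\<exists>x1 y1 x2 y2. generating_pair G x1 y1 \<and> generating_pair G x2 y2 \<and>
        beauville_Sigma G x1 y1 \<inter> beauville_Sigma G x2 y2 = {\<one>\<^bsub>G\<^esub>})"

end

(*
  A non-trivial group without generating pair has d(G) = 1 by convention; otherwise let n be the
  exponent of G. If G^(n/p) is cyclic for a prime p dividing n, it is contained in
  every Sigma set and d(G) = 1. Otherwise a generating pair is a basis of G as a Z/n-module, and
  membership in Sigma sets becomes linear algebra over Z/n. If n is even, the sets of all generating
  pairs contain the whole of G^(n/2), so d(G) = 1. If n is coprime to 6, the two triples of lines
  spanned by (1,0), (0,1), (1,1) and by (1,2), (1,-1), (2,1) meet trivially, so d(G) = 2.
  If n is odd and divisible by 3, G^(n/3) is a plane over F_3, with four lines, and each Sigma set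
  misses exactly one of them; hence at least four sets are needed, and four suffice.
*)
theory Submission
  imports Defs "HOL-Algebra.Multiplicative_Group" "HOL-Computational_Algebra.Primes"
begin

section \<open>Linear congruences and coprimality over the integers\<close>

text \<open>Cramer's rule: eliminating one unknown multiplies the other by the determinant, a unit
  modulo \<open>n\<close>. So two lines over Z/n with unit determinant meet only in zero.\<close>

lemma dvd_if_coprime_det:
  fixes n :: int
  assumes "n dvd a * v - b * u" "n dvd c * v - d * u" "coprime (a * d - b * c) n"
  shows "n dvd u \<and> n dvd v"
proof -
  have "n dvd c * (a * v - b * u) - a * (c * v - d * u)"
    "n dvd d * (a * v - b * u) - b * (c * v - d * u)"
    using assms by (auto intro!: dvd_diff dvd_mult)
  then have "n dvd (a * d - b * c) * u" "n dvd (a * d - b * c) * v"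
    by (simp_all add: algebra_simps)
  then show ?thesis using assms(3) by (simp add: coprime_dvd_mult_right_iff coprime_commute)
qed

lemma coprime_3_iff: "coprime n 3 \<longleftrightarrow> \<not> 3 dvd n" for n :: int
proof -
  have "prime (3::int)" by simp
  then show ?thesis by (metis coprime_commute prime_imp_coprime coprime_absorb_left not_prime_unit)
qed

lemma coprime_6_iff: "coprime n 6 \<longleftrightarrow> odd n \<and> \<not> 3 dvd n" for n :: int
  using coprime_mult_right_iff[of n 2 3] by (simp add: coprime_3_iff)

section \<open>Exponent calculus for pairs of elements\<close>

context comm_group
begin

definition word :: "'a \<Rightarrow> 'a \<Rightarrow> int \<Rightarrow> int \<Rightarrow> 'a" where
  "word x y a b = x [^] a \<otimes> y [^] b"

text \<open>A basis of G as a free Z/n-module of rank two: exponent pairs modulo \<open>n\<close>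
  serve as coordinates.\<close>

definition homocyclic_basis :: "int \<Rightarrow> 'a \<Rightarrow> 'a \<Rightarrow> bool" where
  "homocyclic_basis n x y \<longleftrightarrow> generating_pair G x y \<and>
     (\<forall>a b. word x y a b = \<one> \<longleftrightarrow> n dvd a \<and> n dvd b)"

lemma word_closed [simp, intro]:
  "x \<in> carrier G \<Longrightarrow> y \<in> carrier G \<Longrightarrow> word x y a b \<in> carrier G"
  by (simp add: word_def)

lemma word_0_0 [simp]: "word x y 0 0 = \<one>"
  by (simp add: word_def)

lemma word_1_0 [simp]: "x \<in> carrier G \<Longrightarrow> word x y 1 0 = x"
  by (simp add: word_def)

lemma word_0_1 [simp]: "y \<in> carrier G \<Longrightarrow> word x y 0 1 = y"
  by (simp add: word_def)

lemma word_mult: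
  assumes "x \<in> carrier G" "y \<in> carrier G"
  shows "word x y a b \<otimes> word x y c d = word x y (a + c) (b + d)"
  using assms by (simp add: word_def int_pow_mult m_ac)

lemma word_pow:
  assumes "x \<in> carrier G" "y \<in> carrier G"
  shows "word x y a b [^] (i::int) = word x y (a * i) (b * i)"
  using assms by (simp add: word_def int_pow_distrib int_pow_pow)

lemma word_inv:
  assumes "x \<in> carrier G" "y \<in> carrier G"
  shows "inv (word x y a b) = word x y (- a) (- b)"
  using assms word_pow[of x y a b "-1"] by (simp add: int_pow_neg)

lemma word_word:
  assumes "x \<in> carrier G" "y \<in> carrier G"
  shows "word (word x y a b) (word x y c d) i j = word x y (a * i + c * j) (b * i + d * j)"
  unfolding word_def[of "word x y a b"] using assms by (simp add: word_pow word_mult)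

text \<open>Commutativity collects any product of generators and inverses into one power of
  each.\<close>

lemma generate_pair:
  assumes "x \<in> carrier G" "y \<in> carrier G"
  shows "generate G {x, y} = {g. \<exists>a b. g = word x y a b}"
proof
  show "generate G {x, y} \<subseteq> {g. \<exists>a b. g = word x y a b}"
  proof
    fix g assume "g \<in> generate G {x, y}"
    then have "\<exists>a b. g = word x y a b"
    proof (induction rule: generate.induct)
      case one
      then show ?case by (metis word_0_0)
    next
      case (incl h)
      then show ?case using assms by (metis insertE singletonD word_0_1 word_1_0)
    next
      case (inv h)
      then show ?case using assms
        by (metis insertE singletonD word_0_1 word_1_0 word_inv)
    next
      case (eng h1 h2)
      then show ?case using assms by (metis word_mult)
    qed
    then show "g \<in> {g. \<exists>a b. g = word x y a b}" by simp
  qed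
  have sub: "subgroup (generate G {x, y}) G"
    using assms by (intro generate_is_subgroup) auto
  show "{g. \<exists>a b. g = word x y a b} \<subseteq> generate G {x, y}"
    unfolding word_def
    using subgroup_int_pow_closed[OF sub generate.incl] by (auto intro!: generate.eng)
qed

lemma generating_pair_iff:
  "generating_pair G x y \<longleftrightarrow>
     x \<in> carrier G \<and> y \<in> carrier G \<and> (\<forall>g \<in> carrier G. \<exists>a b. g = word x y a b)"
  unfolding generating_pair_def by (auto simp: generate_pair)

lemma generating_pair_closed:
  "generating_pair G x y \<Longrightarrow> x \<in> carrier G" "generating_pair G x y \<Longrightarrow> y \<in> carrier G"
  by (simp_all add: generating_pair_def)

lemma generating_pair_word:
  assumes "generating_pair G x y" "g \<in> carrier G"
  obtains a b where "g = word x y a b"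
  using assms by (auto simp: generating_pair_iff)

lemma generating_pair_trans:
  assumes "generating_pair G x y" and "u \<in> carrier G" "v \<in> carrier G"
    and "x = word u v a b" "y = word u v c d"
  shows "generating_pair G u v"
  unfolding generating_pair_iff using assms
  by (metis generating_pair_word word_word)

section \<open>Sigma sets of an abelian group\<close>

lemma conjugate_by_eq: "g \<in> carrier G \<Longrightarrow> k \<in> carrier G \<Longrightarrow> conjugate_by G g k = g"
  by (simp add: conjugate_by_def m_comm[of "inv k"] m_assoc)

lemma nat_pow_in_order_range:
  assumes "finite (carrier G)" "x \<in> carrier G"
  shows "(\<exists>i \<in> {1..order G}. g = x [^] i) \<longleftrightarrow> (\<exists>i::int. g = x [^] i)"
proof
  assume "\<exists>i \<in> {1..order G}. g = x [^] i"
  then show "\<exists>i::int. g = x [^] i" by (metis int_pow_int)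
next
  assume "\<exists>i::int. g = x [^] i"
  then obtain i :: int where i: "g = x [^] i" by blast
  have pos: "order G > 0"
    using assms by (simp add: order_gt_0_iff_finite)
  \<comment> \<open>Subtracting one before and adding it after the reduction puts the representative
    into \<open>{1..order G}\<close>, so exponent zero is represented by
    \<open>order G\<close>.\<close>
  define j where "j = nat ((i - 1) mod int (order G)) + 1"
  have "int j = (i - 1) mod int (order G) + 1"
    using pos by (simp add: j_def)
  then have "i = int j + int (order G) * ((i - 1) div int (order G))"
    using mult_div_mod_eq[of "int (order G)" "i - 1"] by linarith
  then have "g = x [^] int j \<otimes> (x [^] int (order G)) [^] ((i - 1) div int (order G))"
    using i assms by (metis int_pow_mult int_pow_pow)
  then have "g = x [^] j"
    using assms by (simp add: int_pow_int pow_order_eq_1)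
  moreover have "j \<in> {1..order G}"
    using pos unfolding j_def
    by (auto simp: Suc_le_eq nat_less_iff)
  ultimately show "\<exists>i \<in> {1..order G}. g = x [^] i" by blast
qed

text \<open>Conjugation is trivial, so the set is a union of three cyclic subgroups; integer
  exponents make these accessible to Bezout arguments.\<close>

lemma beauville_Sigma_iff:
  assumes "finite (carrier G)" "x \<in> carrier G" "y \<in> carrier G"
  shows "g \<in> beauville_Sigma G x y \<longleftrightarrow>
    (\<exists>i::int. g = x [^] i) \<or> (\<exists>i::int. g = y [^] i) \<or> (\<exists>i::int. g = (x \<otimes> y) [^] i)"
proof -
  have "g \<in> beauville_Sigma G x y \<longleftrightarrow>
    (\<exists>i \<in> {1..order G}. g = x [^] i) \<or> (\<exists>i \<in> {1..order G}. g = y [^] i) \<or>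
    (\<exists>i \<in> {1..order G}. g = (x \<otimes> y) [^] i)"
    unfolding beauville_Sigma_def using assms one_closed
    by (auto simp: conjugate_by_eq)
  then show ?thesis
    using assms nat_pow_in_order_range by (metis m_closed)
qed

lemma one_in_beauville_Sigma:
  assumes "finite (carrier G)" "x \<in> carrier G" "y \<in> carrier G"
  shows "\<one> \<in> beauville_Sigma G x y"
  using assms int_pow_0 by (metis beauville_Sigma_iff)

section \<open>Elements lying in every Sigma set\<close>

text \<open>This is the condition of the first branch of \<open>beauville_dimension\<close>. Without
  generating pairs it holds for every non-identity element, so its failure at such an element
  supplies a generating pair.\<close>

definition unavoidable :: "'a \<Rightarrow> bool" where
  "unavoidable g \<longleftrightarrow> g \<in> carrier G \<and> g \<noteq> \<one> \<and>
     (\<forall>x y. generating_pair G x y \<longrightarrow> g \<in> beauville_Sigma G x y)"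

text \<open>The group G^q is cyclic of prime order \<open>p\<close>, so each of its non-identity
  elements generates it. For a generating pair, the \<open>q\<close>-th powers of the two generators
  are not both trivial, and a non-trivial one has \<open>w [^] q\<close> among its powers.\<close>

lemma unavoidable_if_cyclic_power_subgroup:
  fixes p q :: int
  assumes fin: "finite (carrier G)" and p: "prime p"
    and exp: "\<And>g. g \<in> carrier G \<Longrightarrow> g [^] (p * q) = \<one>"
    and w: "w \<in> carrier G" "w [^] q \<noteq> \<one>"
    and cyc: "\<And>g. g \<in> carrier G \<Longrightarrow> \<exists>c::int. g [^] q = (w [^] q) [^] c"
  shows "unavoidable (w [^] q)"
  unfolding unavoidable_def
proof (intro conjI allI impI)
  show "w [^] q \<in> carrier G" "w [^] q \<noteq> \<one>" using w by auto
  fix u v assume gen: "generating_pair G u v"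
  note uv = generating_pair_closed[OF gen]
  \<comment> \<open>Inverting the exponent \<open>c\<close> modulo \<open>p\<close> recovers
    \<open>w [^] q\<close> from \<open>t [^] q\<close>.\<close>
  have power: "\<exists>i::int. w [^] q = t [^] i" if t: "t \<in> carrier G" "t [^] q \<noteq> \<one>" for t
  proof -
    obtain c :: int where c: "t [^] q = (w [^] q) [^] c" using cyc t by blast
    have zp: "(w [^] q) [^] (p * e) = \<one>" for e
      using exp[OF w(1)] w(1) int_pow_pow[of w "p * q" e] by (simp add: int_pow_pow mult_ac)
    have "\<not> p dvd c" using c t zp by (metis dvdE)
    then have "coprime c p" using p by (metis prime_imp_coprime coprime_commute)
    then obtain r s where rs: "r * c + s * p = 1"
      by (metis bezout_int coprime_imp_gcd_eq_1)
    have "w [^] q = (w [^] q) [^] (c * r + p * s)" using rs w by (simp add: mult.commute)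
    also have "\<dots> = ((w [^] q) [^] c) [^] r"
      using w zp by (simp add: int_pow_mult[of "w [^] q"] int_pow_pow[of "w [^] q"])
    also have "\<dots> = t [^] (q * r)" using c t by (simp add: int_pow_pow flip: c)
    finally show ?thesis by blast
  qed
  obtain a b where "w = word u v a b" using generating_pair_word[OF gen w(1)] .
  then have "w [^] q = (u [^] q) [^] a \<otimes> (v [^] q) [^] b"
    using uv by (simp add: word_pow) (simp add: word_def int_pow_pow mult.commute)
  then have "u [^] q \<noteq> \<one> \<or> v [^] q \<noteq> \<one>" using w by auto
  then show "w [^] q \<in> beauville_Sigma G u v"
    using power uv by (auto simp: beauville_Sigma_iff[OF fin uv])
qed

section \<open>The exponent of the group, and generating pairs as bases\<close>

text \<open>Take the least positive exponent; it exists because the order of G is a candidate. By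
  minimality the smaller \<open>n div p\<close> cannot annihilate G.\<close>

lemma ex_exponent:
  assumes fin: "finite (carrier G)"
  obtains n :: int where "n > 0" "\<And>g. g \<in> carrier G \<Longrightarrow> g [^] n = \<one>"
    "\<And>p. prime p \<Longrightarrow> p dvd n \<Longrightarrow> \<exists>g \<in> carrier G. g [^] (n div p) \<noteq> \<one>"
proof -
  define P where "P n \<longleftrightarrow> n > 0 \<and> (\<forall>g \<in> carrier G. g [^] int n = \<one>)" for n
  have "P (order G)" unfolding P_def
    using fin by (simp add: order_gt_0_iff_finite pow_order_eq_1 int_pow_int)
  define n where "n = (LEAST n. P n)"
  have n: "P n" unfolding n_def using \<open>P (order G)\<close> by (rule LeastI)
  show ?thesis
  proof (rule that[of "int n"])
    show "int n > 0" "\<And>g. g \<in> carrier G \<Longrightarrow> g [^] int n = \<one>" using n by (auto simp: P_def)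
    fix p :: int assume p: "prime p" "p dvd int n"
    then obtain q where q: "int n = p * q" by blast
    have "p > 1" using p by (simp add: prime_gt_1_int)
    moreover have "q > 0" using q n \<open>p > 1\<close> by (metis P_def of_nat_0_less_iff zero_less_mult_pos zless_add1_eq zero_less_one order_less_trans)
    ultimately have "q < int n" by (simp add: q)
    then have "\<not> P (nat q)" unfolding n_def by (metis not_less_Least \<open>0 < q\<close> n_def nat_less_iff order_less_imp_le)
    then show "\<exists>g \<in> carrier G. g [^] (int n div p) \<noteq> \<one>"
      using q \<open>q > 0\<close> \<open>p > 1\<close> by (auto simp: P_def)
  qed
qed

text \<open>A relation not divisible by \<open>n\<close> would reduce to one between
  \<open>q\<close>-th powers, with \<open>n = p * q\<close> and exponents not both divisible by the
  prime \<open>p\<close>. This makes G^q cyclic, and a generator of it unavoidable.\<close>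

lemma homocyclic_basis_if_no_unavoidable:
  fixes n :: int
  assumes fin: "finite (carrier G)" and gen: "generating_pair G x y"
    and none: "\<And>g. \<not> unavoidable g"
    and n: "n > 0" and exp: "\<And>g. g \<in> carrier G \<Longrightarrow> g [^] n = \<one>"
    and min: "\<And>p. prime p \<Longrightarrow> p dvd n \<Longrightarrow> \<exists>g \<in> carrier G. g [^] (n div p) \<noteq> \<one>"
  shows "homocyclic_basis n x y"
  unfolding homocyclic_basis_def
proof (intro conjI allI iffI gen)
  note xy = generating_pair_closed[OF gen]
  have pow_n: "g [^] (n * k) = \<one>" if "g \<in> carrier G" for g k
    using exp[OF that] that int_pow_pow[of g n k] by simp
  {
    fix a b assume "n dvd a \<and> n dvd b"
    then show "word x y a b = \<one>" using xy by (auto simp: word_def pow_n elim!: dvdE)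
  }
  fix a b assume ab: "word x y a b = \<one>"
  have "n dvd gcd a b"
  proof (rule ccontr)
    assume notdvd: "\<not> n dvd gcd a b"
    \<comment> \<open>The greatest common divisor of \<open>a\<close>, \<open>b\<close> and
      \<open>n\<close>. It is smaller than \<open>n\<close>, so the cofactor \<open>m\<close> has a
      prime divisor \<open>p\<close>.\<close>
    define d where "d = gcd (gcd a b) n"
    have "d > 0" using n by (simp add: d_def)
    obtain m where m: "n = d * m" by (metis d_def gcd_dvd2 dvdE)
    have "m > 0" using n m \<open>d > 0\<close> by (simp add: zero_less_mult_iff)
    have "m \<noteq> 1" using m notdvd by (metis d_def gcd_dvd1 mult.right_neutral)
    then obtain p where p: "prime p" "p dvd m"
      using \<open>m > 0\<close> by (metis abs_of_pos prime_divisor_exists zdvd1_eq less_irrefl)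
    then obtain r where r: "m = p * r" by blast
    have "p > 0" using p by (simp add: prime_gt_0_int)
    obtain s t where st: "a = d * s" "b = d * t"
      by (metis d_def dvdE dvd_trans gcd_dvd1 gcd_dvd2)
    define q where "q = d * r"
    have nq: "n = p * q" using m r by (simp add: q_def)
    \<comment> \<open>Otherwise \<open>d * p\<close> would also divide \<open>a\<close>,
      \<open>b\<close> and \<open>n\<close>, contradicting the choice of \<open>d\<close>.\<close>
    have not_both: "\<not> (p dvd s \<and> p dvd t)"
    proof
      assume "p dvd s \<and> p dvd t"
      then have "d * p dvd d" unfolding d_def[symmetric]
        using st m p by (subst (2) d_def) (auto intro!: gcd_greatest mult_dvd_mono)
      then have "p dvd 1" using \<open>d > 0\<close> by (metis dvd_mult_cancel_left less_irrefl mult.right_neutral)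
      then show False using p by auto
    qed
    \<comment> \<open>The power \<open>r\<close> turns the exponents \<open>d * s\<close> and
      \<open>d * t\<close> into \<open>q * s\<close> and \<open>q * t\<close>.\<close>
    have "word x y a b [^] r = \<one>" using ab by simp
    then have rel: "x [^] (q * s) \<otimes> y [^] (q * t) = \<one>"
      using xy by (simp add: word_pow) (simp add: st q_def word_def mult_ac)
    \<comment> \<open>Stated for arbitrary \<open>u\<close> and \<open>v\<close>, to be applied to
      the pair in both orders. Inverting \<open>t\<close> modulo \<open>p\<close> makes
      \<open>v [^] q\<close> a power of \<open>u [^] q\<close>.\<close>
    have cyclic: False
      if u: "u \<in> carrier G" and v: "v \<in> carrier G" and gen_uv: "\<forall>g \<in> carrier G. \<exists>a b. g = word u v a b"
        and rel: "u [^] (q * s) \<otimes> v [^] (q * t) = \<one>" and "\<not> p dvd t" for u v s t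
    proof -
      have "coprime t p" using p \<open>\<not> p dvd t\<close> by (metis prime_imp_coprime coprime_commute)
      then obtain i j where ij: "i * t + j * p = 1"
        by (metis bezout_int coprime_imp_gcd_eq_1)
      have "word u v (q * s) (q * t) [^] i = \<one>" using rel by (simp add: word_def)
      then have 1: "u [^] (q * s * i) \<otimes> v [^] (q * t * i) = \<one>"
        using u v by (simp add: word_pow) (simp add: word_def)
      have "q = q * t * i + n * j"
        using ij nq by (metis mult.assoc mult.commute distrib_left mult.right_neutral)
      then have "v [^] q = v [^] (q * t * i)"
        using v pow_n by (metis int_pow_closed int_pow_mult r_one)
      also have "\<dots> = u [^] (- (q * s * i))"
        using 1 u v by (simp add: int_pow_neg) (metis inv_equality int_pow_closed m_comm)
      finally have vq: "v [^] q = (u [^] q) [^] (- (s * i))"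
        using u by (simp add: int_pow_pow mult_ac)
      have cyc: "\<exists>c::int. g [^] q = (u [^] q) [^] c" if "g \<in> carrier G" for g
      proof -
        obtain a b where "g = word u v a b" using gen_uv \<open>g \<in> carrier G\<close> by blast
        then have "g [^] q = (u [^] q) [^] a \<otimes> (v [^] q) [^] b"
          using u v by (simp add: word_pow) (simp add: word_def int_pow_pow mult_ac)
        also have "\<dots> = (u [^] q) [^] (a - s * i * b)"
          using u unfolding vq by (simp add: int_pow_pow int_pow_mult[symmetric] algebra_simps)
        finally show ?thesis by blast
      qed
      \<comment> \<open>Otherwise all \<open>q\<close>-th powers would be trivial, against
        \<open>min\<close> for \<open>q = n div p\<close>.\<close>
      have "u [^] q \<noteq> \<one>"
        using min[OF p(1)] nq cyc \<open>p > 0\<close> by (metis dvd_triv_left int_pow_one nonzero_mult_div_cancel_left less_irrefl)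
      then have "unavoidable (u [^] q)"
        using unavoidable_if_cyclic_power_subgroup[of p q u] fin p u cyc exp nq by blast
      then show False using none by blast
    qed
    have "p dvd t" using cyclic[of x y s t] xy gen rel unfolding generating_pair_iff by blast
    moreover have "p dvd s"
    proof (rule ccontr)
      assume "\<not> p dvd s"
      moreover have "\<forall>g \<in> carrier G. \<exists>a b. g = word y x a b"
        using gen xy unfolding generating_pair_iff word_def by (metis int_pow_closed m_comm)
      moreover have "y [^] (q * t) \<otimes> x [^] (q * s) = \<one>"
        using rel xy by (metis int_pow_closed m_comm)
      ultimately show False using cyclic[of y x t s] xy by blast
    qed
    ultimately show False using not_both by blast
  qed
  then show "n dvd a" "n dvd b" by auto
qed

section \<open>Coordinates modulo \<open>n\<close> with respect to a fixed basis\<close>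

context
  fixes n :: int and x y :: 'a
  assumes fin: "finite (carrier G)" and basis: "homocyclic_basis n x y"
begin

lemma basis_gen: "generating_pair G x y"
  using basis by (simp add: homocyclic_basis_def)

lemma basis_closed [simp]: "x \<in> carrier G" "y \<in> carrier G"
  using basis_gen by (auto dest: generating_pair_closed)

lemma word_eq_one_iff: "word x y a b = \<one> \<longleftrightarrow> n dvd a \<and> n dvd b"
  using basis by (simp add: homocyclic_basis_def)

lemma word_eq_iff: "word x y a b = word x y c d \<longleftrightarrow> n dvd a - c \<and> n dvd b - d"
proof -
  have "word x y a b = word x y c d \<longleftrightarrow> word x y a b \<otimes> inv (word x y c d) = \<one>"
    by (metis basis_closed inv_closed r_inv word_closed inv_equality inv_inv)
  then show ?thesis by (simp add: word_inv word_mult word_eq_one_iff)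
qed

lemma pow_cong:
  assumes "g \<in> carrier G" "n dvd i - j"
  shows "g [^] i = g [^] j"
proof -
  obtain a b where g: "g = word x y a b" using generating_pair_word[OF basis_gen assms(1)] .
  have "n dvd a * (i - j)" "n dvd b * (i - j)" using assms(2) by auto
  then show ?thesis unfolding g by (simp add: word_pow word_eq_iff right_diff_distrib)
qed

text \<open>With \<open>q = n div 2\<close>, an exponent \<open>a * q\<close> matters only through
  the parity of \<open>a\<close>. Hence \<open>x [^] q\<close> is one of the \<open>q\<close>-th
  powers of \<open>u\<close>, \<open>v\<close> and \<open>u \<otimes> v\<close>, whichever
  generating pair is taken.\<close>

lemma even_unavoidable:
  assumes "n > 0" "even n"
  shows "unavoidable (x [^] (n div 2))"
proof -
  define q where "q = n div 2"
  have q: "n = 2 * q" "q > 0" using assms by (auto simp: q_def)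
  have even: "g [^] (a * q) = \<one>" if "g \<in> carrier G" "even a" for g a
    using pow_cong[of g "a * q" 0] that q by auto
  have odd: "g [^] (a * q) = g [^] q" if "g \<in> carrier G" "odd a" for g a
  proof (rule pow_cong[OF that(1)])
    have "a * q - q = (a - 1) * q" by (simp add: left_diff_distrib)
    then show "n dvd a * q - q" using that q by (auto intro!: mult_dvd_mono)
  qed
  have "word x y q 0 \<noteq> \<one>" using q by (auto simp: word_eq_one_iff dest: zdvd_imp_le)
  then have "x [^] q \<noteq> \<one>" by (simp add: word_def)
  moreover have "x [^] q \<in> beauville_Sigma G u v" if gen: "generating_pair G u v" for u v
  proof -
    note uv = generating_pair_closed[OF gen]
    obtain a b where "x = word u v a b" using generating_pair_word[OF gen, of x] by auto
    then have "x [^] q = u [^] (a * q) \<otimes> v [^] (b * q)" using uv by (simp add: word_pow) (simp add: word_def)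
    then have "x [^] q \<in> {\<one>, u [^] q, v [^] q, (u \<otimes> v) [^] q}"
      using uv by (cases "even a"; cases "even b") (simp_all add: even odd int_pow_distrib)
    then show ?thesis using \<open>x [^] q \<noteq> \<one>\<close>
      by (auto simp: beauville_Sigma_iff[OF fin uv])
  qed
  ultimately show ?thesis by (simp add: unavoidable_def q_def)
qed

text \<open>The coordinates of a power of \<open>word x y a b\<close> are a multiple of
  \<open>(a, b)\<close>, so their determinant with \<open>(a, b)\<close> vanishes modulo
  \<open>n\<close>. This yields congruences in the form of
  \<open>dvd_if_coprime_det\<close>.\<close>

lemma word_in_beauville_SigmaD:
  assumes "word x y u v \<in> beauville_Sigma G (word x y a b) (word x y c d)"
  shows "n dvd a * v - b * u \<or> n dvd c * v - d * u \<or> n dvd (a + c) * v - (b + d) * u"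
proof -
  have det: "n dvd a * v - b * u" if "word x y u v = word x y a b [^] i" for a b and i :: int
  proof -
    have "n dvd u - a * i" "n dvd v - b * i" using that by (simp_all add: word_pow word_eq_iff)
    then have "n dvd a * (v - b * i) - b * (u - a * i)" by (meson dvd_diff dvd_mult)
    moreover have "a * (v - b * i) - b * (u - a * i) = a * v - b * u" by (simp add: algebra_simps)
    ultimately show ?thesis by simp
  qed
  show ?thesis
    using assms det by (auto simp: beauville_Sigma_iff[OF fin] word_mult)
qed

lemma words_generate:
  assumes "coprime (a * d - b * c) n"
  shows "generating_pair G (word x y a b) (word x y c d)"
proof -
  obtain r s where rs: "r * (a * d - b * c) + s * n = 1"
    using assms by (metis bezout_int coprime_imp_gcd_eq_1)
  then have dvd: "n dvd r * (a * d - b * c) - 1"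
    by (metis add_diff_cancel_left' dvd_minus_iff dvd_triv_right minus_diff_eq)
  \<comment> \<open>Here and below, the new exponents come from the inverse matrix: the adjugate
    times \<open>r\<close>, the inverse of the determinant modulo \<open>n\<close>.\<close>
  have "word x y (a * (r * d) + c * (- r * b)) (b * (r * d) + d * (- r * b)) = word x y 1 0"
    using dvd unfolding word_eq_iff by (simp add: algebra_simps)
  moreover have "word x y (a * (- r * c) + c * (r * a)) (b * (- r * c) + d * (r * a)) = word x y 0 1"
    using dvd unfolding word_eq_iff by (simp add: algebra_simps)
  ultimately show ?thesis
    using generating_pair_trans[OF basis_gen] by (metis basis_closed word_closed word_word word_0_1 word_1_0)
qed

lemma beauville_group_if_coprime_6:
  assumes "coprime n 6" "n > 1"
  shows "beauville_group G"
  unfolding beauville_group_def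
proof (intro conjI exI)
  have co: "coprime 2 n" "coprime 3 n"
    using assms(1) coprime_6_iff coprime_3_iff by (simp_all add: coprime_commute)
  show "group G" by (rule is_group)
  show "finite (carrier G)" by (rule fin)
  have "x \<noteq> \<one>"
    using word_eq_one_iff[of 1 0] assms(2) by auto
  then show "carrier G \<noteq> {\<one>}" using basis_closed by blast
  show "generating_pair G (word x y 1 0) (word x y 0 1)"
    by (rule words_generate) simp
  \<comment> \<open>The determinant is -3, so coprimality to 3 enters here.\<close>
  show "generating_pair G (word x y 1 2) (word x y 1 (- 1))"
    using co by (intro words_generate) simp
  have "g = \<one>"
    if g: "g \<in> beauville_Sigma G (word x y 1 0) (word x y 0 1)"
      "g \<in> beauville_Sigma G (word x y 1 2) (word x y 1 (- 1))" for g
  proof -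
    have "g \<in> carrier G" using g(1) by (auto simp: beauville_Sigma_iff[OF fin] word_mult)
    then obtain u v where uv: "g = word x y u v" by (rule generating_pair_word[OF basis_gen])
    have "n dvd 1 * v - 0 * u \<or> n dvd 0 * v - 1 * u \<or> n dvd 1 * v - 1 * u"
      using word_in_beauville_SigmaD[of u v 1 0 0 1] g(1) uv by simp
    moreover have "n dvd 1 * v - 2 * u \<or> n dvd 1 * v - (- 1) * u \<or> n dvd 2 * v - 1 * u"
      using word_in_beauville_SigmaD[of u v 1 2 1 "- 1"] g(2) uv by simp
    \<comment> \<open>All nine determinants between a line of the first triple and one of the second
      are plus or minus 1 or 2, hence units modulo \<open>n\<close>.\<close>
    ultimately have "n dvd u \<and> n dvd v"
      using co by (elim disjE) (erule (1) dvd_if_coprime_det; simp)+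
    then show ?thesis by (simp add: uv word_eq_one_iff)
  qed
  then show "beauville_Sigma G (word x y 1 0) (word x y 0 1) \<inter>
      beauville_Sigma G (word x y 1 2) (word x y 1 (- 1)) = {\<one>}"
    by (auto intro!: one_in_beauville_Sigma fin)
qed

lemma four_sets_if_odd:
  assumes "odd n"
  shows "\<exists>u v. (\<forall>i \<in> {1..4}. generating_pair G (u i) (v i)) \<and>
    (\<Inter>i \<in> {1..4::nat}. beauville_Sigma G (u i) (v i)) = {\<one>}"
proof -
  \<comment> \<open>The four triples of lines miss a different line each modulo 3, and all their 2 by 2
    determinants that matter are plus or minus 1 or 2, so one choice works for every odd \<open>n\<close>.\<close>
  define A where "A = (\<lambda>_::nat. (0::int, 1::int)) (1 := (1, 0), 2 := (1, 0))"
  define B where "B = (\<lambda>_::nat. (1::int, - 1::int)) (1 := (0, 1), 4 := (1, 1))"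
  define u where "u i = word x y (fst (A i)) (snd (A i))" for i
  define v where "v i = word x y (fst (B i)) (snd (B i))" for i
  have all4: "(\<forall>i \<in> {1..4::nat}. P i) \<longleftrightarrow> P 1 \<and> P 2 \<and> P 3 \<and> P 4" for P
  proof -
    have "{1..4::nat} = {1, 2, 3, 4}" by auto
    then show ?thesis by simp
  qed
  have gen: "\<forall>i \<in> {1..4}. generating_pair G (u i) (v i)"
    unfolding all4 u_def v_def A_def B_def by (simp add: words_generate del: word_1_0 word_0_1)
  have "g = \<one>" if g: "\<forall>i \<in> {1..4}. g \<in> beauville_Sigma G (u i) (v i)" for g
  proof -
    have "g \<in> carrier G" using g unfolding all4 u_def v_def
      by (auto simp: beauville_Sigma_iff[OF fin] word_mult)
    then obtain a b where ab: "g = word x y a b" by (rule generating_pair_word[OF basis_gen])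
    have D: "n dvd fst (A i) * b - snd (A i) * a \<or> n dvd fst (B i) * b - snd (B i) * a \<or>
        n dvd (fst (A i) + fst (B i)) * b - (snd (A i) + snd (B i)) * a" if "i \<in> {1..4}" for i
      using g that unfolding u_def v_def ab by (intro word_in_beauville_SigmaD) blast
    have D1: "n dvd 1 * b - 0 * a \<or> n dvd 0 * b - 1 * a \<or> n dvd 1 * b - 1 * a"
      using D[of 1] by (simp add: A_def B_def)
    have D2: "n dvd 1 * b - 0 * a \<or> n dvd 1 * b - (- 1) * a \<or> n dvd 2 * b - (- 1) * a"
      using D[of 2] by (simp add: A_def B_def)
    have D3: "n dvd 0 * b - 1 * a \<or> n dvd 1 * b - (- 1) * a \<or> n dvd 1 * b - 0 * a"
      using D[of 3] by (simp add: A_def B_def)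
    have D4: "n dvd 0 * b - 1 * a \<or> n dvd 1 * b - 1 * a \<or> n dvd 1 * b - 2 * a"
      using D[of 4] by (simp add: A_def B_def)
    \<comment> \<open>As an atom, \<open>Z\<close> lets the final case analysis be purely
      propositional.\<close>
    define Z where "Z \<longleftrightarrow> n dvd a \<and> n dvd b"
    note det = dvd_if_coprime_det[where u = a and v = b and n = n, folded Z_def]
    \<comment> \<open>The six incompatible pairs of lines collected here settle every case of
      \<open>D1\<close>: the line of \<open>(1, 0)\<close> clashes with \<open>D4\<close>, that of
      \<open>(0, 1)\<close> with \<open>D2\<close>, and for \<open>(1, 1)\<close> only
      \<open>(0, 1)\<close> remains in \<open>D3\<close>.\<close>
    have "n dvd 1 * b - 0 * a \<Longrightarrow> n dvd 0 * b - 1 * a \<Longrightarrow> Z" by (erule (1) det) simp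
    moreover have "n dvd 1 * b - 1 * a \<Longrightarrow> n dvd 1 * b - (- 1) * a \<Longrightarrow> Z" by (erule (1) det) (simp add: assms)
    moreover have "n dvd 0 * b - 1 * a \<Longrightarrow> n dvd 1 * b - (- 1) * a \<Longrightarrow> Z" by (erule (1) det) simp
    moreover have "n dvd 0 * b - 1 * a \<Longrightarrow> n dvd 2 * b - (- 1) * a \<Longrightarrow> Z" by (erule (1) det) (simp add: assms)
    moreover have "n dvd 1 * b - 0 * a \<Longrightarrow> n dvd 1 * b - 1 * a \<Longrightarrow> Z" by (erule (1) det) simp
    moreover have "n dvd 1 * b - 0 * a \<Longrightarrow> n dvd 1 * b - 2 * a \<Longrightarrow> Z" by (erule (1) det) (simp add: assms)
    ultimately have Z using D1 D2 D3 D4 by blast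
    then show ?thesis by (simp add: ab word_eq_one_iff Z_def)
  qed
  moreover have "\<forall>i \<in> {1..4}. \<one> \<in> beauville_Sigma G (u i) (v i)"
    unfolding u_def v_def by (auto intro!: one_in_beauville_Sigma fin)
  ultimately have "(\<Inter>i \<in> {1..4}. beauville_Sigma G (u i) (v i)) = {\<one>}" by blast
  then show ?thesis using gen by blast
qed

text \<open>A count in \<open>K\<close>, the group of \<open>q\<close>-th powers for
  \<open>n = 3 * q\<close>: it has at least eight non-identity elements, each must be missed by some
  Sigma set, and one set misses at most two.\<close>

lemma at_least_four_sets_if_3_dvd:
  assumes "3 dvd n" "n > 0"
    and gen: "\<forall>i \<in> {1..d::nat}. generating_pair G (u i) (v i)"
    and inter: "(\<Inter>i \<in> {1..d}. beauville_Sigma G (u i) (v i)) = {\<one>}"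
  shows "d \<ge> 4"
proof -
  obtain q where q: "n = 3 * q" using assms(1) by blast
  have "q > 0" using q assms(2) by simp
  define K where "K = (\<lambda>g. g [^] q) ` carrier G"
  have "finite K" using fin by (simp add: K_def)
  \<comment> \<open>Coordinates 0, \<open>q\<close> and \<open>2 * q\<close> are distinct modulo
    \<open>n\<close>, which gives nine elements of \<open>K\<close>.\<close>
  define f where "f = (\<lambda>(a, b). word x y (a * q) (b * q))"
  have "inj_on f ({0..2} \<times> {0..2})"
  proof (rule inj_onI)
    fix s t :: "int \<times> int"
    assume s: "s \<in> {0..2} \<times> {0..2}" and t: "t \<in> {0..2} \<times> {0..2}" and "f s = f t"
    then have "n dvd fst s * q - fst t * q" "n dvd snd s * q - snd t * q"
      by (auto simp: f_def word_eq_iff split: prod.splits)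
    then have "3 dvd fst s - fst t" "3 dvd snd s - snd t"
      using \<open>q > 0\<close> by (simp_all add: q flip: left_diff_distrib)
    moreover have "fst s \<in> {0..2}" "snd s \<in> {0..2}" "fst t \<in> {0..2}" "snd t \<in> {0..2}"
      using s t by (auto simp: mem_Times_iff)
    ultimately have "fst s = fst t" "snd s = snd t" unfolding atLeastAtMost_iff by presburger+
    then show "s = t" by (rule prod_eqI)
  qed
  moreover have "f ` ({0..2} \<times> {0..2}) \<subseteq> K"
    by (auto simp: f_def K_def simp flip: word_pow)
  ultimately have "card ({0..2::int} \<times> {0..2::int}) \<le> card K"
    using \<open>finite K\<close> by (metis card_image card_mono)
  then have card_K: "9 \<le> card K" by (simp add: card_cartesian_product)
  \<comment> \<open>Only the line of \<open>u v\<^sup>-\<^sup>1\<close> in \<open>K\<close> is missed, and it has two non-identity elements.\<close>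
  have card_missed: "card (K - beauville_Sigma G u v) \<le> 2"
    if gen: "generating_pair G u v" for u v
  proof -
    note uv = generating_pair_closed[OF gen]
    have reduce: "h [^] (a * q) = h [^] (b * q)" if "h \<in> carrier G" "3 dvd a - b" for h a b
      using pow_cong[OF that(1), of "a * q" "b * q"] that(2)
      by (simp add: q flip: left_diff_distrib)
    have "K - beauville_Sigma G u v \<subseteq> {word u v (1 * q) (- 1 * q), word u v (- 1 * q) (1 * q)}"
    proof
      fix g assume g: "g \<in> K - beauville_Sigma G u v"
      then obtain h where h: "h \<in> carrier G" "g = h [^] q" by (auto simp: K_def)
      obtain a b where "h = word u v a b" using generating_pair_word[OF gen h(1)] .
      then have gab: "g = u [^] (a * q) \<otimes> v [^] (b * q)"
        using uv h by (simp add: word_pow) (simp add: word_def)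
      have notin: "g \<noteq> u [^] i" "g \<noteq> v [^] i" "g \<noteq> u [^] i \<otimes> v [^] i" for i :: int
        using g uv by (auto simp: beauville_Sigma_iff[OF fin uv] int_pow_distrib)
      \<comment> \<open>Avoiding the three lines makes \<open>a\<close> and \<open>b\<close>
        non-zero and distinct modulo 3, leaving 1 and -1 in either order.\<close>
      have "\<not> 3 dvd a" using gab notin(2)[of "b * q"] reduce[OF uv(1), of a 0] uv by auto
      moreover have "\<not> 3 dvd b" using gab notin(1)[of "a * q"] reduce[OF uv(2), of b 0] uv by auto
      moreover have "\<not> 3 dvd a - b" using gab notin(3)[of "b * q"] reduce[OF uv(1), of a b] by auto
      ultimately have "3 dvd a - 1 \<and> 3 dvd b - (- 1) \<or> 3 dvd a - (- 1) \<and> 3 dvd b - 1"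
        by presburger
      then show "g \<in> {word u v (1 * q) (- 1 * q), word u v (- 1 * q) (1 * q)}"
        unfolding gab word_def
        using reduce[OF uv(1), of a] reduce[OF uv(2), of b] by (elim disjE conjE) (simp_all only: insert_iff simp_thms)
    qed
    then have "card (K - beauville_Sigma G u v)
        \<le> card {word u v (1 * q) (- 1 * q), word u v (- 1 * q) (1 * q)}"
      by (intro card_mono) auto
    also have "\<dots> \<le> 2" by (simp add: card_insert_if)
    finally show ?thesis .
  qed
  have "K \<subseteq> {\<one>} \<union> (\<Union>i \<in> {1..d}. K - beauville_Sigma G (u i) (v i))" using inter by blast
  then have "card K \<le> card ({\<one>} \<union> (\<Union>i \<in> {1..d}. K - beauville_Sigma G (u i) (v i)))"
    using \<open>finite K\<close> by (intro card_mono) auto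
  also have "\<dots> \<le> card {\<one>} + card (\<Union>i \<in> {1..d}. K - beauville_Sigma G (u i) (v i))"
    by (rule card_Un_le)
  also have "card (\<Union>i \<in> {1..d}. K - beauville_Sigma G (u i) (v i))
      \<le> (\<Sum>i \<in> {1..d}. card (K - beauville_Sigma G (u i) (v i)))"
    by (rule card_UN_le) simp
  also have "\<dots> \<le> (\<Sum>i \<in> {1..d}. 2)" using gen card_missed by (intro sum_mono) blast
  finally show ?thesis using card_K by simp
qed

section \<open>Power subgroups and splitting along coprime factors\<close>

text \<open>Exponents are scaled by \<open>r\<close>, and \<open>r * m\<close> divides
  \<open>r * a\<close> exactly when \<open>m\<close> divides \<open>a\<close>. The results on bases
  thus apply again inside \<open>H\<close>, with modulus \<open>m\<close>.\<close>

lemma homocyclic_basis_power_subgroup: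
  fixes r m :: int
  assumes n: "n = r * m" and "r \<noteq> 0"
  defines "H \<equiv> G\<lparr>carrier := generate G {x [^] r, y [^] r}\<rparr>"
  shows "comm_group H" and "comm_group.homocyclic_basis H m (x [^] r) (y [^] r)"
proof -
  have sub: "subgroup (generate G {x [^] r, y [^] r}) G"
    by (rule generate_is_subgroup) auto
  then have "group H" unfolding H_def by (rule subgroup_imp_group)
  moreover have "a \<otimes> b = b \<otimes> a"
    if "a \<in> generate G {x [^] r, y [^] r}" "b \<in> generate G {x [^] r, y [^] r}" for a b
    using that sub by (meson m_comm subgroup.mem_carrier)
  ultimately show "comm_group H" by (auto simp: H_def intro!: group.group_comm_groupI)
  then interpret H: comm_group H .
  have inH: "x [^] r \<in> generate G {x [^] r, y [^] r}" "y [^] r \<in> generate G {x [^] r, y [^] r}"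
    by (auto intro: generate.incl)
  have word: "H.word (x [^] r) (y [^] r) a b = word x y (r * a) (r * b)" for a b
    unfolding H.word_def word_def using inH sub
    by (simp add: H_def int_pow_consistent[symmetric] int_pow_pow)
  have "generating_pair H (x [^] r) (y [^] r)"
    unfolding generating_pair_def using inH sub by (simp add: H_def generate_consistent)
  moreover have "H.word (x [^] r) (y [^] r) a b = \<one>\<^bsub>H\<^esub> \<longleftrightarrow> m dvd a \<and> m dvd b" for a b
    unfolding word using word_eq_one_iff[of "r * a" "r * b"] n \<open>r \<noteq> 0\<close> by (simp add: H_def)
  ultimately show "H.homocyclic_basis m (x [^] r) (y [^] r)"
    unfolding H.homocyclic_basis_def by blast
qed

text \<open>The Chinese remainder theorem in both coordinates: words with exponents divisible by
  \<open>m\<close> form the part isomorphic to the square of Z/r, and those with exponents divisible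
  by \<open>r\<close> form the last factor.\<close>

lemma iso_split_coprime:
  fixes r :: nat and m :: int
  assumes n: "n = int r * m" and "r > 0" "m \<noteq> 0" and co: "coprime (int r) m"
  shows "G \<cong> integer_mod_group r \<times>\<times> integer_mod_group r \<times>\<times>
    G\<lparr>carrier := generate G {x [^] int r, y [^] int r}\<rparr>"
proof -
  let ?H = "G\<lparr>carrier := generate G {x [^] int r, y [^] int r}\<rparr>"
  let ?P = "integer_mod_group r \<times>\<times> integer_mod_group r \<times>\<times> ?H"
  have H: "h \<in> carrier ?H \<longleftrightarrow> (\<exists>c d. h = word x y (int r * c) (int r * d))" for h
    by (auto simp: generate_pair word_def int_pow_pow)
  have grp: "group ?H"
    by (intro subgroup_imp_group generate_is_subgroup) auto
  have P: "group ?P" by (intro DirProd_group grp) auto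
  define f where "f = (\<lambda>(a, b, h). word x y (m * a) (m * b) \<otimes> h)"
  \<comment> \<open>Reduction modulo \<open>r\<close> in the cyclic factors changes
    \<open>m * a\<close> by a multiple of \<open>n\<close>, so \<open>f\<close> respects their
    addition.\<close>
  have m_mod: "n dvd m * (a mod int r) - m * a" for a
  proof -
    have "m * (a mod int r) - m * a = n * - (a div int r)"
      using n by (simp add: minus_div_mult_eq_mod[symmetric] algebra_simps)
    then show ?thesis by simp
  qed
  have carrierH: "h \<in> carrier G" if "h \<in> carrier ?H" for h using that H by auto
  have "f \<in> hom ?P G"
  proof (rule homI)
    fix s assume "s \<in> carrier ?P"
    then show "f s \<in> carrier G" using carrierH by (auto simp: f_def split: prod.splits)
  next
    fix s t assume st: "s \<in> carrier ?P" "t \<in> carrier ?P"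
    obtain a b h where s: "s = (a, b, h)" by (cases s)
    obtain c d k where t: "t = (c, d, k)" by (cases t)
    have hk: "h \<in> carrier G" "k \<in> carrier G" using st carrierH by (auto simp: s t)
    have "f (s \<otimes>\<^bsub>?P\<^esub> t) =
        word x y (m * ((a + c) mod int r)) (m * ((b + d) mod int r)) \<otimes> (h \<otimes> k)"
      by (simp add: f_def s t)
    also have "word x y (m * ((a + c) mod int r)) (m * ((b + d) mod int r)) =
        word x y (m * (a + c)) (m * (b + d))"
      using m_mod by (simp add: word_eq_iff)
    also have "\<dots> = word x y (m * a) (m * b) \<otimes> word x y (m * c) (m * d)"
      by (simp add: word_mult distrib_left)
    finally show "f (s \<otimes>\<^bsub>?P\<^esub> t) = f s \<otimes> f t"
      using hk by (simp add: f_def s t m_ac)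
  qed
  then interpret f: group_hom ?P G f
    using P by (simp add: group_hom_def group_hom_axioms_def)
  have "inj_on f (carrier ?P)"
    unfolding f.inj_on_one_iff
  proof (intro allI impI)
    fix s assume s: "s \<in> carrier ?P" "f s = \<one>"
    obtain a b h where abh: "s = (a, b, h)" by (cases s)
    obtain c d where h: "h = word x y (int r * c) (int r * d)" using s H by (auto simp: abh)
    have ab: "0 \<le> a" "a < int r" "0 \<le> b" "b < int r"
      using s \<open>r > 0\<close> by (auto simp: abh carrier_integer_mod_group)
    have "n dvd m * a + int r * c" "n dvd m * b + int r * d"
      using s(2) by (simp_all add: f_def abh h word_mult word_eq_one_iff)
    \<comment> \<open>Modulo \<open>r\<close> the contribution of \<open>h\<close> disappears, and
      \<open>m\<close> can be cancelled. The range of \<open>a\<close> and \<open>b\<close> then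
      forces both to be zero.\<close>
    then have "int r dvd m * a + int r * c" "int r dvd m * b + int r * d"
      using n by (auto intro: dvd_trans)
    then have "int r dvd a" "int r dvd b"
      using co by (simp_all add: dvd_add_left_iff coprime_dvd_mult_right_iff)
    then have "a = 0" "b = 0" using ab by (auto dest: zdvd_imp_le)
    then show "s = \<one>\<^bsub>?P\<^esub>" using s(2) carrierH s(1) by (simp add: f_def abh)
  qed
  moreover have "f ` carrier ?P = carrier G"
  proof
    show "f ` carrier ?P \<subseteq> carrier G" by auto
    show "carrier G \<subseteq> f ` carrier ?P"
    proof
      fix g assume "g \<in> carrier G"
      then obtain a b where g: "g = word x y a b" by (rule generating_pair_word[OF basis_gen])
      obtain i j where ij: "i * int r + j * m = 1"
        using co by (metis bezout_int coprime_imp_gcd_eq_1)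
      \<comment> \<open>The Bezout coefficients split each exponent into a multiple of
        \<open>m\<close> and a multiple of \<open>r\<close>.\<close>
      let ?s = "((j * a) mod int r, (j * b) mod int r, word x y (int r * (i * a)) (int r * (i * b)))"
      have split: "m * (j * c) + int r * (i * c) = c" for c
      proof -
        have "m * (j * c) + int r * (i * c) = (i * int r + j * m) * c" by (simp add: algebra_simps)
        then show ?thesis by (simp add: ij)
      qed
      have "word x y (m * ((j * a) mod int r)) (m * ((j * b) mod int r)) = word x y (m * (j * a)) (m * (j * b))"
        using m_mod by (simp add: word_eq_iff)
      then have "f ?s = g"
        by (simp add: f_def g word_mult split)
      moreover have "?s \<in> carrier ?P"
        using \<open>r > 0\<close> H by (auto simp: carrier_integer_mod_group)
      ultimately show "g \<in> f ` carrier ?P" by blast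
    qed
  qed
  ultimately have "f \<in> iso ?P G" using f.homh by (simp add: iso_def bij_betw_def)
  then show ?thesis using P by (meson group.iso_sym is_isoI)
qed

end

section \<open>Values of the Beauville dimension\<close>

lemma beauville_dimension_eq_1_if_unavoidable:
  "unavoidable g \<Longrightarrow> beauville_dimension G = 1"
  unfolding beauville_dimension_def unavoidable_def by auto

lemma beauville_dimension_eq_Least:
  assumes "\<And>g. \<not> unavoidable g"
  shows "beauville_dimension G = (LEAST d. d \<ge> 1 \<and>
    (\<exists>u v :: nat \<Rightarrow> 'a. (\<forall>i \<in> {1..d}. generating_pair G (u i) (v i)) \<and>
      (\<Inter>i \<in> {1..d}. beauville_Sigma G (u i) (v i)) = {\<one>}))"
  using assms unfolding beauville_dimension_def unavoidable_def by (subst if_not_P) blast+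

text \<open>The convention does not apply, as there is no non-identity element; the minimum is
  attained by the pair of identities.\<close>

lemma beauville_dimension_trivial:
  assumes "carrier G = {\<one>}"
  shows "beauville_dimension G = 1"
proof -
  have fin: "finite (carrier G)" using assms by simp
  have "generating_pair G \<one> \<one>"
    unfolding generating_pair_iff using assms by (auto simp: word_def)
  moreover have "beauville_Sigma G \<one> \<one> = {\<one>}"
    by (auto simp: beauville_Sigma_iff[OF fin])
  moreover have "\<not> unavoidable g" for g using assms by (auto simp: unavoidable_def)
  ultimately show ?thesis
    by (subst beauville_dimension_eq_Least) (auto intro!: Least_equality exI[of _ "\<lambda>_. \<one>"])
qed

text \<open>An unavoidable element would lie in the trivial intersection of the two sets. One set is
  too few: it contains its generating pair, so a trivial set would make G trivial.\<close>

lemma beauville_dimension_eq_2_if_beauville_group: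
  assumes "beauville_group G"
  shows "beauville_dimension G = 2"
proof -
  have fin: "finite (carrier G)" and nontrivial: "carrier G \<noteq> {\<one>}"
    using assms by (auto simp: beauville_group_def)
  obtain u1 v1 u2 v2 where uv: "generating_pair G u1 v1" "generating_pair G u2 v2"
    "beauville_Sigma G u1 v1 \<inter> beauville_Sigma G u2 v2 = {\<one>}"
    using assms by (auto simp: beauville_group_def)
  have none: "\<not> unavoidable g" for g using uv by (auto simp: unavoidable_def)
  have no_1: "beauville_Sigma G u v \<noteq> {\<one>}" if gen: "generating_pair G u v" for u v
  proof
    assume eq: "beauville_Sigma G u v = {\<one>}"
    note c = generating_pair_closed[OF gen]
    have "u \<in> beauville_Sigma G u v" "v \<in> beauville_Sigma G u v"
      using c int_pow_1 by (metis beauville_Sigma_iff[OF fin c])+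
    then have "u = \<one>" "v = \<one>" using eq by auto
    then have "carrier G = {\<one>}" using gen by (auto simp: generating_pair_iff word_def)
    then show False using nontrivial by simp
  qed
  have 2: "{1..2::nat} = {1, 2}" by auto
  show ?thesis
    unfolding beauville_dimension_eq_Least[OF none]
  proof (rule Least_equality)
    show "2 \<ge> (1::nat) \<and> (\<exists>u v :: nat \<Rightarrow> 'a. (\<forall>i \<in> {1..2}. generating_pair G (u i) (v i)) \<and>
      (\<Inter>i \<in> {1..2}. beauville_Sigma G (u i) (v i)) = {\<one>})"
    proof (intro conjI exI)
      let ?u = "\<lambda>i::nat. if i = 1 then u1 else u2" and ?v = "\<lambda>i::nat. if i = 1 then v1 else v2"
      show "\<forall>i \<in> {1..2}. generating_pair G (?u i) (?v i)" using uv by simp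
      show "(\<Inter>i \<in> {1..2}. beauville_Sigma G (?u i) (?v i)) = {\<one>}"
        unfolding 2 using uv by simp
    qed simp
  next
    fix d :: nat
    assume d: "d \<ge> 1 \<and> (\<exists>u v :: nat \<Rightarrow> 'a. (\<forall>i \<in> {1..d}. generating_pair G (u i) (v i)) \<and>
      (\<Inter>i \<in> {1..d}. beauville_Sigma G (u i) (v i)) = {\<one>})"
    have "d \<noteq> 1"
    proof
      assume "d = 1"
      then obtain u v :: "nat \<Rightarrow> 'a"
        where "generating_pair G (u 1) (v 1)" "beauville_Sigma G (u 1) (v 1) = {\<one>}"
        using d by auto
      then show False using no_1 by blast
    qed
    then show "2 \<le> d" using d by simp
  qed
qed

lemma beauville_dimension_eq_4:
  fixes n :: int
  assumes "finite (carrier G)" "homocyclic_basis n x y" "n > 0" "3 dvd n" "odd n"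
    and none: "\<And>g. \<not> unavoidable g"
  shows "beauville_dimension G = 4"
  unfolding beauville_dimension_eq_Least[OF none]
  using four_sets_if_odd[OF assms(1,2,5)] at_least_four_sets_if_3_dvd[OF assms(1,2,4,3)]
  by (intro Least_equality) auto

text \<open>Write \<open>n = 3 ^ k * m\<close> with \<open>m\<close> prime to 3 and split along
  these factors. The complement has a basis of modulus \<open>m\<close>, coprime to 6, so it is
  trivial for \<open>m = 1\<close> and a Beauville group otherwise.\<close>

lemma power_3_split:
  fixes n :: int
  assumes basis: "finite (carrier G)" "homocyclic_basis n x y" and n: "n > 0" "3 dvd n" "odd n"
  shows "\<exists>(r::nat) (k::nat) (H :: ('a, 'b) monoid_scheme). k \<ge> 1 \<and> r = 3 ^ k \<and>
    (trivial_group H \<or> (comm_group H \<and> beauville_group H)) \<and>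
    G \<cong> integer_mod_group r \<times>\<times> integer_mod_group r \<times>\<times> H"
proof -
  define k where "k = multiplicity 3 n"
  have "k \<ge> 1" unfolding k_def using n by (auto simp: Suc_le_eq multiplicity_gt_zero_iff)
  obtain m where m: "n = 3 ^ k * m" "\<not> 3 dvd m"
    unfolding k_def using n(1) by (auto intro: multiplicity_decompose'[of n 3])
  have "m > 0" using m(1) n(1) by (simp add: zero_less_mult_iff)
  have "odd m" using m n by auto
  have "coprime m 3" using coprime_3_iff m(2) by blast
  let ?r = "3 ^ k :: nat"
  let ?H = "G\<lparr>carrier := generate G {x [^] int ?r, y [^] int ?r}\<rparr>"
  have nr: "n = int ?r * m" using m by simp
  have "coprime (int ?r) m" using \<open>coprime m 3\<close> by (simp add: coprime_commute)
  then have iso: "G \<cong> integer_mod_group ?r \<times>\<times> integer_mod_group ?r \<times>\<times> ?H"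
    using iso_split_coprime[OF basis nr] \<open>m > 0\<close> by simp
  have comm: "comm_group ?H" and Hbasis: "comm_group.homocyclic_basis ?H m (x [^] int ?r) (y [^] int ?r)"
    using homocyclic_basis_power_subgroup[OF basis nr] by simp_all
  interpret H: comm_group ?H by (rule comm)
  have xy: "x \<in> carrier G" "y \<in> carrier G" using basis_closed[OF basis] by auto
  have "carrier ?H \<subseteq> carrier G" using generate_incl[of "{x [^] int ?r, y [^] int ?r}"] xy by simp
  then have finH: "finite (carrier ?H)" using basis(1) by (rule finite_subset)
  have "trivial_group ?H \<or> beauville_group ?H"
  proof (cases "m = 1")
    case True
    have "h = \<one>\<^bsub>?H\<^esub>" if h: "h \<in> carrier ?H" for h
    proof -
      obtain a b where "h = H.word (x [^] int ?r) (y [^] int ?r) a b"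
        using H.generating_pair_word[OF H.basis_gen[OF finH Hbasis] h] .
      then show ?thesis using H.word_eq_one_iff[OF finH Hbasis, of a b] True by simp
    qed
    then have "trivial_group ?H" unfolding H.trivial_group_subset by blast
    then show ?thesis ..
  next
    case False
    have "coprime m 6" using coprime_6_iff m(2) \<open>odd m\<close> by blast
    then show ?thesis
      using H.beauville_group_if_coprime_6[OF finH Hbasis] False \<open>m > 0\<close> by simp
  qed
  then show ?thesis using iso comm \<open>k \<ge> 1\<close> by blast
qed

end

theorem corollary2p10:
  fixes G :: "('a, 'b) monoid_scheme"
  assumes "comm_group G" and "finite (carrier G)"
  shows "beauville_dimension G \<in> {1, 2, 4} \<and>
    (beauville_dimension G = 1 \<longrightarrow> \<not> generalised_beauville_group G) \<and>
    (beauville_dimension G = 2 \<longrightarrow> beauville_group G) \<and>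
    (beauville_dimension G = 4 \<longrightarrow>
       generalised_beauville_group G \<and>
       (\<exists>(n::nat) (k::nat) (H :: ('a, 'b) monoid_scheme).
          k \<ge> 1 \<and> n = 3 ^ k \<and>
          (trivial_group H \<or> (comm_group H \<and> beauville_group H)) \<and>
          G \<cong> integer_mod_group n \<times>\<times> integer_mod_group n \<times>\<times> H))"
proof -
  interpret comm_group G by (rule assms(1))
  note fin = assms(2)
  show ?thesis
  proof (cases "(\<exists>g. unavoidable g) \<or> carrier G = {\<one>\<^bsub>G\<^esub>}")
    case True
    then have "beauville_dimension G = 1"
      using beauville_dimension_eq_1_if_unavoidable beauville_dimension_trivial by blast
    then show ?thesis by (simp add: generalised_beauville_group_def)
  next
    case False
    then have none: "\<And>g. \<not> unavoidable g" by blast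
    obtain g where "g \<in> carrier G" "g \<noteq> \<one>\<^bsub>G\<^esub>" using False by blast
    \<comment> \<open>A generating pair exists because the non-identity element \<open>g\<close> is
      missed by the Sigma set of one.\<close>
    then obtain x y where gen: "generating_pair G x y"
      using none[of g] by (auto simp: unavoidable_def)
    obtain n :: int where n: "n > 0" "\<And>g. g \<in> carrier G \<Longrightarrow> g [^]\<^bsub>G\<^esub> n = \<one>\<^bsub>G\<^esub>"
      "\<And>p. prime p \<Longrightarrow> p dvd n \<Longrightarrow> \<exists>g \<in> carrier G. g [^]\<^bsub>G\<^esub> (n div p) \<noteq> \<one>\<^bsub>G\<^esub>"
      using ex_exponent[OF fin] by blast
    have basis: "homocyclic_basis n x y"
      using homocyclic_basis_if_no_unavoidable[OF fin gen none n] .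
    have "odd n" using even_unavoidable[OF fin basis n(1)] none by blast
    \<comment> \<open>Exponent 1 would make \<open>g\<close> trivial; the criterion for Beauville
      groups requires \<open>n > 1\<close>.\<close>
    have "n \<noteq> 1"
      using n(2) \<open>g \<in> carrier G\<close> \<open>g \<noteq> \<one>\<^bsub>G\<^esub>\<close> by auto
    show ?thesis
    proof (cases "3 dvd n")
      case True
      have "beauville_dimension G = 4"
        using beauville_dimension_eq_4[OF fin basis n(1) True \<open>odd n\<close> none] .
      then show ?thesis
        using power_3_split[OF fin basis n(1) True \<open>odd n\<close>] fin is_group
        by (simp add: generalised_beauville_group_def)
    next
      case False
      then have "coprime n 6" using coprime_6_iff \<open>odd n\<close> by blast
      then have "beauville_group G"
        using beauville_group_if_coprime_6[OF fin basis] n(1) \<open>n \<noteq> 1\<close> by simp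
      then show ?thesis
        using beauville_dimension_eq_2_if_beauville_group by simp
    qed
  qed
qed

end
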